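(* Let $c\approx 0.613763$ be the root of the equation $(x-1)^2x=\frac{8}{27(1+\sqrt5)}$ lying in $(1/3,1]$, and let $p\in(c,1]$. Then for the Labouchere game with win probability $p$ started from any nonempty finite list $L_0=(\ell_1,\dots,\ell_j)$ of positive real numbers, the maximal bet $M$ satisfies $E[M]<\infty$.
   Context: A list is a finite (possibly empty) sequence $L=(\ell_1,\dots,\ell_j)$ of positive real numbers. The bet $b(L)$ is defined by $b(L)=0$ if $j=0$, $b(L)=\ell_1$ if $j=1$, and $b(L)=\ell_1+\ell_j$ if $j\ge 2$. For a list $L=(\ell_1,\dots,\ell_j)$ define the updated lists: $L[1]=\emptyset$ if $j\le 2$ and $L[1]=(\ell_2,\dots,\ell_{j-1})$ if $j\ge 3$ (a win erases the first and last entries); $L[-1]=\emptyset$ if $j=0$ and $L[-1]=(\ell_1,\dots,\ell_j,b(L))$ if $j\ge1$ (a loss appends the bet). Let $X_1,X_2,\dots$ be i.i.d. random variables with $P(X_i=1)=p\in[1/3,1]$ and $P(X_i=-1)=q:=1-p$. The Labouchere game with win probability $p$ started from the list $L_0$ is the sequence of lists $L_{i+1}=L_i[X_{i+1}]$. The stopping time $N$ is the number of turns taken before the list becomes empty (for $p\in[1/3,1]$ it is finite with probability $1$). The maximal bet is $M:=\sup_m b(L_m)$. *)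

theory Defs
  imports "HOL-Probability.Probability"
begin

fun bet :: "real list \<Rightarrow> real" where
  "bet [] = 0"
| "bet [l] = l"
| "bet (l # l' # ls) = l + last (l' # ls)"

text \<open>The outcome \<open>1\<close> is a win, any other value counts as a loss. In the games considered the
  outcomes are almost surely \<open>1\<close> or \<open>-1\<close>. Since \<open>tl [] = []\<close> and \<open>butlast [] = []\<close>, a win turns
  every list of length at most 2 into the empty one.\<close>

definition update :: "real list \<Rightarrow> int \<Rightarrow> real list" where
  "update L x =
     (if x = 1 then butlast (tl L) else if L = [] then [] else L @ [bet L])"

text \<open>The outcome of turn \<open>i\<close> is \<open>x i\<close> with \<open>i \<ge> 1\<close>; \<open>x 0\<close> is not used.\<close>

primrec labouchere :: "real list \<Rightarrow> (nat \<Rightarrow> int) \<Rightarrow> nat \<Rightarrow> real list" where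
  "labouchere L\<^sub>0 x 0 = L\<^sub>0"
| "labouchere L\<^sub>0 x (Suc i) = update (labouchere L\<^sub>0 x i) (x (Suc i))"

text \<open>Bets on lists of positive reals are nonnegative, so \<open>ennreal\<close> does not truncate them. The
  supremum may be infinite.\<close>

definition max_bet :: "real list \<Rightarrow> (nat \<Rightarrow> int) \<Rightarrow> ennreal" where
  "max_bet L\<^sub>0 x = (SUP m. ennreal (bet (labouchere L\<^sub>0 x m)))"

definition crit_prob :: real where
  "crit_prob = (THE x. 1/3 < x \<and> x \<le> 1 \<and> (x - 1)\<^sup>2 * x = 8 / (27 * (1 + sqrt 5)))"

lemma crit_prob_cubic_strict_antimono:
  fixes a b :: real
  assumes "1/3 < a" "a < b" "b \<le> 1"
  shows "(b - 1)\<^sup>2 * b < (a - 1)\<^sup>2 * a"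
proof (rule DERIV_neg_imp_decreasing_open[OF assms(2)])
  fix x :: real assume x: "a < x" "x < b"
  have "((\<lambda>x. (x - 1)\<^sup>2 * x) has_real_derivative (x - 1) * (3 * x - 1)) (at x)"
    by (auto intro!: derivative_eq_intros simp: power2_eq_square algebra_simps)
  moreover have "(x - 1) * (3 * x - 1) < 0"
    using x assms by (intro mult_neg_pos) auto
  ultimately show "\<exists>y. ((\<lambda>x. (x - 1)\<^sup>2 * x) has_real_derivative y) (at x) \<and> y < 0" by blast
qed (intro continuous_intros)

lemma crit_prob_root_exists:
  "\<exists>x::real. 0.6137625 \<le> x \<and> x \<le> 0.6137635 \<and> (x - 1)\<^sup>2 * x = 8 / (27 * (1 + sqrt 5))"
proof -
  have "sqrt 5 \<le> 2.236068" by (rule real_le_lsqrt) (auto simp: power2_eq_square)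
  moreover have "2.236067 \<le> sqrt 5" by (rule real_le_rsqrt) (auto simp: power2_eq_square)
  ultimately have "8 / (27 * (1 + sqrt 5)) \<le> (0.6137625 - 1)\<^sup>2 * (0.6137625::real)"
    "(0.6137635 - 1)\<^sup>2 * (0.6137635::real) \<le> 8 / (27 * (1 + sqrt 5))"
    by (simp_all add: field_simps power2_eq_square)
  then show ?thesis
    by (intro IVT2[where f = "\<lambda>x. (x - 1)\<^sup>2 * x"]) (auto intro!: continuous_intros)
qed

lemma crit_prob_root_ex1:
  "\<exists>!x::real. 1/3 < x \<and> x \<le> 1 \<and> (x - 1)\<^sup>2 * x = 8 / (27 * (1 + sqrt 5))"
proof -
  obtain r :: real where r: "0.6137625 \<le> r" "r \<le> 0.6137635"
    "(r - 1)\<^sup>2 * r = 8 / (27 * (1 + sqrt 5))"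
    using crit_prob_root_exists by blast
  show ?thesis
  proof (rule ex1I[of _ r])
    show "1/3 < r \<and> r \<le> 1 \<and> (r - 1)\<^sup>2 * r = 8 / (27 * (1 + sqrt 5))" using r by auto
    fix y :: real assume y: "1/3 < y \<and> y \<le> 1 \<and> (y - 1)\<^sup>2 * y = 8 / (27 * (1 + sqrt 5))"
    have "1/3 < r" "r \<le> 1" using r by auto
    then show "y = r"
      using crit_prob_cubic_strict_antimono[of y r] crit_prob_cubic_strict_antimono[of r y] y r(3)
      by (cases y r rule: linorder_cases) auto
  qed
qed

lemma crit_prob_props:
  "1/3 < crit_prob" "crit_prob \<le> 1" "(crit_prob - 1)\<^sup>2 * crit_prob = 8 / (27 * (1 + sqrt 5))"
  using theI'[OF crit_prob_root_ex1] unfolding crit_prob_def by auto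

lemma crit_prob_approx: "\<bar>crit_prob - 0.613763\<bar> \<le> 0.0000005"
proof -
  obtain r :: real where r: "0.6137625 \<le> r" "r \<le> 0.6137635"
    "(r - 1)\<^sup>2 * r = 8 / (27 * (1 + sqrt 5))"
    using crit_prob_root_exists by blast
  moreover have "1/3 < r" "r \<le> 1" using r by auto
  ultimately have "crit_prob = r"
    using crit_prob_root_ex1 crit_prob_props by blast
  then show ?thesis using r(1,2) unfolding abs_le_iff by simp
qed

end

theory Submission
  imports Defs
begin

text \<open>
  Along any fixed sequence of outcomes the bets grow at most like \<open>\<phi>\<^sup>w\<close>, up to a factor linear in
  the length of the list, where \<open>w\<close> counts the wins so far and \<open>\<phi>\<close> is the golden ratio. The reason
  is that a losing streak adds the same first entry over and over, which is linear growth; only a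
  win replaces the first entry by a later one. The worst case is a list kept so short that each
  new entry is the sum of the previous two, as in the Fibonacci sequence.

  A win shortens the list by 2 and a loss lengthens it by 1. Hence for \<open>u > 1\<close> and as long as the
  list is not empty, \<open>\<phi>\<^sup>w u\<^sup>l\<close> with \<open>l\<close> the length of the list is, up to a constant factor, the
  product of one factor per turn: \<open>\<phi> / u\<^sup>2\<close> for a win and \<open>u\<close> for a loss. The power of \<open>u\<close> absorbs
  the linear factor, so this product dominates the bets (\<open>bet_le_turn_weights\<close>). Since the turns are
  independent, its expectation after \<open>n\<close> turns is \<open>\<rho>\<^sup>n\<close> with \<open>\<rho> = \<phi> p / u\<^sup>2 + u (1 - p)\<close>. The
  infimum of \<open>\<rho>\<close> over \<open>u > 0\<close> is less than 1 exactly when \<open>(27/4) \<phi> p (1 - p)\<^sup>2 < 1\<close>, which is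
  what \<open>crit_prob < p\<close> says (\<open>subcritical_tilt\<close>). The supremum of the bets is at most their sum,
  and that has expectation at most a constant times the convergent series of the \<open>\<rho>\<^sup>n\<close>.
\<close>

definition golden_ratio :: real where
  "golden_ratio = (1 + sqrt 5) / 2"

lemma golden_ratio_square: "golden_ratio * golden_ratio = golden_ratio + 1"
proof -
  have "sqrt 5 * sqrt 5 = (5::real)" by simp
  then show ?thesis unfolding golden_ratio_def by (simp add: field_simps)
qed

lemma golden_ratio_bounds: "1 < golden_ratio" "golden_ratio < 2"
proof -
  have "sqrt 5 < (3::real)" by (rule real_less_lsqrt) auto
  moreover have "1 < sqrt (5::real)" by simp
  ultimately show "1 < golden_ratio" "golden_ratio < 2" unfolding golden_ratio_def by auto
qed

text \<open>The profile bounds the entries relative to the bound on the first entry. It is closed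
  under both moves: a loss adds the first entry to the last one, so the profile must increase by at
  least \<open>1\<close> at each index from \<open>1\<close> on, and a win shifts the indices by one and may cost a factor
  \<open>\<phi>\<close>. The smaller first step, from \<open>1\<close> to \<open>\<phi>\<close>, is possible since the bet on a one-element list is
  that element and not its double; without it the factor would have to be 2.\<close>

definition entry_profile :: "nat \<Rightarrow> real" where
  "entry_profile m = (if m = 0 then 1 else real m - 1 + golden_ratio)"

lemma entry_profile_ge_1: "1 \<le> entry_profile m"
  using golden_ratio_bounds by (auto simp: entry_profile_def)

lemma entry_profile_0: "entry_profile 0 = 1"
  by (simp add: entry_profile_def)

lemma entry_profile_add_1: "0 < m \<Longrightarrow> 1 + entry_profile m = entry_profile (Suc m)"
  by (simp add: entry_profile_def)

lemma entry_profile_shift: "entry_profile (Suc m) \<le> golden_ratio * entry_profile m"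
proof (cases "m = 0")
  case False
  then have "0 \<le> (golden_ratio - 1) * (real m - 1)"
    using golden_ratio_bounds by simp
  then show ?thesis
    using False golden_ratio_square by (simp add: entry_profile_def algebra_simps)
qed (simp add: entry_profile_def)

lemma entry_profile_le_power:
  assumes "1 < u"
  shows "entry_profile n \<le> (1 + 1 / (u - 1)) * u ^ n"
proof -
  have "entry_profile n \<le> 1 + real n"
    using golden_ratio_bounds by (simp add: entry_profile_def)
  also have "\<dots> \<le> 1 + real n + (1 / (u - 1) + real n * (u - 1))"
    using assms by simp
  also have "\<dots> = (1 + 1 / (u - 1)) * (1 + real n * (u - 1))"
    using assms by (simp add: distrib_left distrib_right)
  also have "\<dots> \<le> (1 + 1 / (u - 1)) * u ^ n"
    using assms Bernoulli_inequality[of "u - 1" n] by (intro mult_left_mono) auto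
  finally show ?thesis .
qed

definition turn_weight :: "real \<Rightarrow> int \<Rightarrow> real" where
  "turn_weight u x = (if x = 1 then golden_ratio / u\<^sup>2 else u)"

lemma turn_weight_nonneg: "0 < u \<Longrightarrow> 0 \<le> turn_weight u x"
  using golden_ratio_bounds by (auto simp: turn_weight_def)

lemma bet_eq: "bet L = (if L = [] then 0 else if length L = 1 then hd L else hd L + last L)"
  by (cases L rule: bet.cases) auto

text \<open>The factor \<open>a\<close> takes the value \<open>C \<phi>\<^sup>w u\<^sup>l\<close> with \<open>w\<close> the number of wins so far and \<open>l\<close> the length
  of the list. Keeping \<open>u\<^sup>l\<close> on the left as well lets one number carry both the growth of the entries
  and the length, so that each turn only multiplies it by a weight depending on the outcome.\<close>

definition dominated :: "real \<Rightarrow> real \<Rightarrow> real list \<Rightarrow> bool" where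
  "dominated u a L \<longleftrightarrow> (\<forall>m<length L. L ! m * u ^ length L \<le> a * entry_profile m)"

text \<open>A lost bet becomes the entry with index \<open>length L\<close>, so the profile at that index is the bound
  that a loss needs.\<close>

lemma bet_le_if_dominated:
  assumes "dominated u a L" "0 \<le> a" "L \<noteq> []"
  shows "bet L * u ^ length L \<le> a * entry_profile (length L)"
proof -
  have first: "L ! 0 * u ^ length L \<le> a"
    using assms by (auto simp: dominated_def entry_profile_0 dest: spec[of _ 0])
  show ?thesis
  proof (cases "length L = 1")
    case True
    have "a * 1 \<le> a * entry_profile (length L)"
      using assms(2) entry_profile_ge_1 by (rule mult_left_mono[rotated])
    with True first assms(3) show ?thesis by (simp add: bet_eq hd_conv_nth)
  next
    case False
    then obtain k where k: "length L = Suc k" "0 < k"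
      using assms(3) by (cases "length L") auto
    then have "last L * u ^ length L \<le> a * entry_profile k"
      using assms(1,3) by (auto simp: dominated_def last_conv_nth)
    with first have "(hd L + last L) * u ^ length L \<le> a * (1 + entry_profile k)"
      using assms(3) by (simp add: hd_conv_nth algebra_simps)
    then show ?thesis
      using k False assms(3) by (simp add: bet_eq entry_profile_add_1)
  qed
qed

text \<open>The weight of a turn is what makes the invariant below self-reproducing: the factor \<open>\<phi>\<close> of a
  win pays for the index shift, and the powers of \<open>u\<close> follow the change of length.\<close>

lemma dominated_update:
  assumes "dominated u a L" "0 \<le> a" "0 < u"
  shows "dominated u (a * turn_weight u x) (update L x)"
proof (cases "x = 1")
  case True
  show ?thesis unfolding dominated_def
  proof (intro allI impI)
    fix m assume "m < length (update L x)"
    with True obtain k where k: "length L = k + 2" "m < k"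
      by (cases "length L < 2") (auto simp: update_def dest!: le_Suc_ex[of 2] simp: not_less)
    have "update L x ! m = L ! Suc m" "length (update L x) = k"
      using True k by (simp_all add: update_def nth_butlast nth_tl)
    moreover have "L ! Suc m * u ^ (k + 2) \<le> a * entry_profile (Suc m)"
      using assms(1) k unfolding dominated_def by (metis Suc_less_eq add_2_eq_Suc' less_Suc_eq)
    moreover have "a * entry_profile (Suc m) \<le> a * (golden_ratio * entry_profile m)"
      using assms(2) entry_profile_shift by (intro mult_left_mono)
    ultimately have "update L x ! m * u ^ length (update L x) * u\<^sup>2
        \<le> a * golden_ratio * entry_profile m"
      unfolding power_add mult.assoc by simp
    then show "update L x ! m * u ^ length (update L x) \<le> a * turn_weight u x * entry_profile m"
      using True assms(3) by (simp add: turn_weight_def field_simps)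
  qed
next
  case False
  show ?thesis
  proof (cases "L = []")
    case True
    with False show ?thesis by (simp add: update_def dominated_def)
  next
    case L: False
    have "(L @ [bet L]) ! m * u ^ length L \<le> a * entry_profile m" if "m < Suc (length L)" for m
      using that assms(1) bet_le_if_dominated[OF assms(1,2) L]
      by (cases "m = length L") (auto simp: dominated_def nth_append)
    then have "u * ((L @ [bet L]) ! m * u ^ length L) \<le> u * (a * entry_profile m)"
      if "m < Suc (length L)" for m
      using that assms(3) by (intro mult_left_mono) auto
    then show ?thesis
      using False L by (simp add: update_def dominated_def turn_weight_def mult_ac)
  qed
qed

lemma dominated_labouchere:
  assumes "dominated u a L" "0 \<le> a" "0 < u"
  shows "dominated u (a * (\<Prod>i=1..n. turn_weight u (x i))) (labouchere L x n)"
proof (induction n)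
  case (Suc n)
  have "0 \<le> a * (\<Prod>i=1..n. turn_weight u (x i))"
    using assms turn_weight_nonneg by (intro mult_nonneg_nonneg prod_nonneg) auto
  from dominated_update[OF Suc this assms(3)] show ?case by (simp add: mult_ac)
qed (use assms in simp)

text \<open>Only the exponential factor survives here: the linear growth of the profile is absorbed by
  \<open>u\<^sup>l\<close> with \<open>l\<close> the length of the list, which is why \<open>u\<close> has to exceed 1.\<close>

lemma bet_le_turn_weights:
  assumes "1 < u"
  obtains K where "0 \<le> K" "\<And>x n. bet (labouchere L x n) \<le> K * (\<Prod>i=1..n. turn_weight u (x i))"
proof -
  define C where "C = Max (insert 0 (set L))"
  define a where "a = C * u ^ length L"
  have C: "0 \<le> C" "\<And>l. l \<in> set L \<Longrightarrow> l \<le> C"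
    by (auto simp: C_def)
  have a: "0 \<le> a" using C assms by (simp add: a_def)
  have start: "dominated u a L" unfolding dominated_def
  proof (intro allI impI)
    fix m assume "m < length L"
    then have "L ! m * u ^ length L \<le> a * 1"
      using C(2)[of "L ! m"] assms by (simp add: a_def)
    also have "\<dots> \<le> a * entry_profile m"
      using a entry_profile_ge_1 by (intro mult_left_mono)
    finally show "L ! m * u ^ length L \<le> a * entry_profile m" .
  qed
  define D where "D = 1 + 1 / (u - 1)"
  have D: "0 \<le> D" using assms by (simp add: D_def)
  show ?thesis
  proof (rule that[of "a * D"])
    show "0 \<le> a * D" using a D by simp
    fix x :: "nat \<Rightarrow> int" and n
    let ?G = "\<Prod>i=1..n. turn_weight u (x i)" and ?L = "labouchere L x n"
    have G: "0 \<le> ?G" using assms turn_weight_nonneg by (intro prod_nonneg) auto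
    show "bet ?L \<le> a * D * ?G"
    proof (cases "?L = []")
      case True
      with a D G show ?thesis by simp
    next
      case False
      have "bet ?L * u ^ length ?L \<le> a * ?G * entry_profile (length ?L)"
        using dominated_labouchere[OF start a, of x n] assms a G False
        by (intro bet_le_if_dominated) auto
      also have "\<dots> \<le> a * ?G * (D * u ^ length ?L)"
        using a G entry_profile_le_power[OF assms] unfolding D_def
        by (intro mult_left_mono) auto
      finally have "bet ?L * u ^ length ?L \<le> a * D * ?G * u ^ length ?L"
        by (simp add: mult_ac)
      then show ?thesis
        using assms by simp
    qed
  qed
qed

lemma subcritical_tilt:
  assumes "crit_prob < p" "p \<le> 1"
  obtains u where "1 < u" "golden_ratio / u\<^sup>2 * p + u * (1 - p) < 1"
proof (cases "p = 1")
  case True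
  show ?thesis
    by (rule that[of 2]) (use True golden_ratio_bounds in auto)
next
  case False
  define q where "q = 1 - p"
  have q: "0 < q" "q < 2 / 3"
    using False assms crit_prob_props(1) by (auto simp: q_def)
  have "(p - 1)\<^sup>2 * p < (crit_prob - 1)\<^sup>2 * crit_prob"
    using assms crit_prob_props(1) by (intro crit_prob_cubic_strict_antimono)
  also have "\<dots> = 4 / (27 * golden_ratio)"
    by (simp add: crit_prob_props(3) golden_ratio_def)
  finally have cubic: "27 * golden_ratio * (q\<^sup>2 * p) < 4"
    using golden_ratio_bounds by (simp add: field_simps q_def power2_commute)
  \<comment> \<open>The minimum over \<open>u\<close> lies at \<open>u\<^sup>3 = 2 \<phi> p / q\<close>; on the critical curve this equals \<open>2 / (3 q)\<close>,
    which is the more convenient choice: the second summand becomes \<open>2 / 3\<close>.\<close>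
  show ?thesis
  proof (rule that[of "2 / (3 * q)"])
    show "1 < 2 / (3 * q)" using q by simp
    have "golden_ratio / (2 / (3 * q))\<^sup>2 * p = 9 * golden_ratio * (q\<^sup>2 * p) / 4"
      using q by (simp add: field_simps power2_eq_square)
    also have "\<dots> < 1 / 3" using cubic by simp
    finally have "golden_ratio / (2 / (3 * q))\<^sup>2 * p < 1 / 3" .
    moreover have "2 / (3 * q) * (1 - p) = 2 / 3"
      using q by (simp add: q_def[symmetric])
    ultimately show "golden_ratio / (2 / (3 * q))\<^sup>2 * p + 2 / (3 * q) * (1 - p) < 1"
      by linarith
  qed
qed

lemma (in prob_space) nn_integral_turn_weight:
  fixes Y :: "'a \<Rightarrow> int"
  assumes "random_variable (count_space UNIV) Y" "0 < u"
    and "prob {\<omega> \<in> space M. Y \<omega> = 1} = p"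
  shows "(\<integral>\<^sup>+\<omega>. ennreal (turn_weight u (Y \<omega>)) \<partial>M) = ennreal (golden_ratio / u\<^sup>2 * p + u * (1 - p))"
proof -
  let ?W = "{\<omega> \<in> space M. Y \<omega> = 1}"
  have W: "?W \<in> events" using assms(1) by measurable
  have p: "0 \<le> p" "p \<le> 1" using assms(3) by auto
  have "(\<integral>\<^sup>+\<omega>. ennreal (turn_weight u (Y \<omega>)) \<partial>M)
      = (\<integral>\<^sup>+\<omega>. ennreal (golden_ratio / u\<^sup>2) * indicator ?W \<omega>
          + ennreal u * indicator (space M - ?W) \<omega> \<partial>M)"
    by (intro nn_integral_cong) (auto simp: turn_weight_def)
  also have "\<dots> = ennreal (golden_ratio / u\<^sup>2) * ennreal p + ennreal u * ennreal (1 - p)"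
    using W assms(3) prob_compl[OF W]
    by (subst nn_integral_add) (auto simp: nn_integral_cmult_indicator emeasure_eq_measure)
  also have "\<dots> = ennreal (golden_ratio / u\<^sup>2 * p + u * (1 - p))"
    using p assms(2) golden_ratio_bounds
    by (simp flip: ennreal_mult ennreal_plus)
  finally show ?thesis .
qed

theorem theorem1p1:
  fixes P :: "'a measure" and X :: "nat \<Rightarrow> 'a \<Rightarrow> int" and p :: real and L\<^sub>0 :: "real list"
  assumes "prob_space P"
    and "prob_space.indep_vars P (\<lambda>_. count_space UNIV) X {1..}"
    and "\<And>i. i \<ge> 1 \<Longrightarrow> measure P {\<omega> \<in> space P. X i \<omega> = 1} = p"
    and "\<And>i. i \<ge> 1 \<Longrightarrow> measure P {\<omega> \<in> space P. X i \<omega> = - 1} = 1 - p"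
    and "crit_prob < p" and "p \<le> 1"
    and "L\<^sub>0 \<noteq> []" and "\<And>l. l \<in> set L\<^sub>0 \<Longrightarrow> l > 0"
  shows "(\<integral>\<^sup>+\<omega>. max_bet L\<^sub>0 (\<lambda>i. X i \<omega>) \<partial>P) < \<infinity>"
proof -
  interpret prob_space P by fact
  obtain u where u: "1 < u" "golden_ratio / u\<^sup>2 * p + u * (1 - p) < 1"
    using subcritical_tilt assms(5,6) by blast
  define \<rho> where "\<rho> = golden_ratio / u\<^sup>2 * p + u * (1 - p)"
  have \<rho>: "0 \<le> \<rho>" "\<rho> < 1"
    using u golden_ratio_bounds assms(5,6) crit_prob_props(1) by (auto simp: \<rho>_def)
  obtain K where K: "0 \<le> K"
    "\<And>x n. bet (labouchere L\<^sub>0 x n) \<le> K * (\<Prod>i=1..n. turn_weight u (x i))"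
    using bet_le_turn_weights[OF u(1)] by blast
  have X [measurable]: "X i \<in> measurable P (count_space UNIV)" if "i \<in> {1..}" for i
    using assms(2) that unfolding indep_vars_def by auto
  let ?G = "\<lambda>n \<omega>. \<Prod>i=1..n. ennreal (turn_weight u (X i \<omega>))"
  have meas: "?G n \<in> borel_measurable P" for n
    using X by (intro borel_measurable_prod_ennreal) auto
  have mean: "(\<integral>\<^sup>+\<omega>. ?G n \<omega> \<partial>P) = ennreal (\<rho> ^ n)" for n
  proof -
    have "indep_vars (\<lambda>_. count_space UNIV) X {1..n}"
      using assms(2) by (rule indep_vars_subset) auto
    then have "indep_vars (\<lambda>_. borel) (\<lambda>i \<omega>. ennreal (turn_weight u (X i \<omega>))) {1..n}"
      by (rule indep_vars_compose2) simp
    then have "(\<integral>\<^sup>+\<omega>. ?G n \<omega> \<partial>P) = (\<Prod>i=1..n. \<integral>\<^sup>+\<omega>. ennreal (turn_weight u (X i \<omega>)) \<partial>P)"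
      by (intro indep_vars_nn_integral) auto
    also have "\<dots> = (\<Prod>i=1..n. ennreal \<rho>)"
      using u(1) X assms(3) unfolding \<rho>_def by (intro prod.cong refl nn_integral_turn_weight) auto
    finally show ?thesis using \<rho>(1) by (simp add: ennreal_power)
  qed
  have "max_bet L\<^sub>0 (\<lambda>i. X i \<omega>) \<le> (\<Sum>n. ennreal K * ?G n \<omega>)" for \<omega>
    unfolding max_bet_def
  proof (rule SUP_least)
    fix n
    have "ennreal (bet (labouchere L\<^sub>0 (\<lambda>i. X i \<omega>) n))
        \<le> ennreal (K * (\<Prod>i=1..n. turn_weight u (X i \<omega>)))"
      by (intro ennreal_leI K(2))
    also have "\<dots> = ennreal K * ?G n \<omega>"
      using K(1) u(1) turn_weight_nonneg by (simp add: ennreal_mult prod_nonneg prod_ennreal)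
    also have "\<dots> \<le> (\<Sum>n. ennreal K * ?G n \<omega>)"
      using sum_le_suminf[of "\<lambda>n. ennreal K * ?G n \<omega>" "{n}"] by simp
    finally show "ennreal (bet (labouchere L\<^sub>0 (\<lambda>i. X i \<omega>) n)) \<le> (\<Sum>n. ennreal K * ?G n \<omega>)" .
  qed
  then have "(\<integral>\<^sup>+\<omega>. max_bet L\<^sub>0 (\<lambda>i. X i \<omega>) \<partial>P) \<le> (\<integral>\<^sup>+\<omega>. (\<Sum>n. ennreal K * ?G n \<omega>) \<partial>P)"
    by (intro nn_integral_mono)
  also have "\<dots> = (\<Sum>n. \<integral>\<^sup>+\<omega>. ennreal K * ?G n \<omega> \<partial>P)"
    by (intro nn_integral_suminf borel_measurable_times_ennreal borel_measurable_const meas)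
  also have "\<dots> = (\<Sum>n. ennreal (K * \<rho> ^ n))"
    unfolding nn_integral_cmult[OF meas] mean using K(1) \<rho>(1) by (simp add: ennreal_mult)
  also have "\<dots> = ennreal (\<Sum>n. K * \<rho> ^ n)"
    using K(1) \<rho> by (intro suminf_ennreal2) (auto intro!: summable_mult summable_geometric)
  also have "\<dots> < \<infinity>" by simp
  finally show ?thesis .
qed

end
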